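(* For any integer $r>1$ there is a transitive action of the free group $F_r$ of rank $r$ whose growth with respect to one free basis of $F_r$ is maximal, while with respect to another free basis of $F_r$ its growth is not just non-maximal, but its growth function is actually bounded from above, for all sufficiently large $n$, by a function of the form $(2r-1-\gamma)^n$, for some $\gamma>0$.
   Context: For a transitive right action of $F_r$ on a set $S$, a point $o\in S$ and a free basis $X$ of $F_r$, the growth function with respect to $X$ is $g(n)=\#\{ow : w\in F_r,\ |w|_X\le n\}$, where $|w|_X$ is the length of the reduced word in $X\cup X^{-1}$ representing $w$. Functions $f,g$ are equivalent if for some nonnegative integers $C,C'$ one has $f(n)\le g(n+C)$ and $g(n)\le f(n+C')$ for all $n\ge0$; the class of the growth function with respect to a fixed basis does not depend on $o$. The growth with respect to $X$ is maximal if $g$ is equivalent to $(2r-1)^n$ (the growth of the action of $F_r$ on itself). *)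

theory Defs
  imports Complex_Main "HOL-Algebra.Group"
begin

text \<open>
  Words in \<open>X \<union> X\<inverse>\<close> are lists of formal letters: \<open>(x, True)\<close> stands for \<open>x\<close> and
  \<open>(x, False)\<close> for the inverse of \<open>x\<close>.
\<close>

definition letter_val :: "('a, 'm) monoid_scheme \<Rightarrow> 'a \<times> bool \<Rightarrow> 'a" where
  "letter_val G l = (if snd l then fst l else inv\<^bsub>G\<^esub> (fst l))"

definition word_val :: "('a, 'm) monoid_scheme \<Rightarrow> ('a \<times> bool) list \<Rightarrow> 'a" where
  "word_val G w = foldr (\<lambda>l g. letter_val G l \<otimes>\<^bsub>G\<^esub> g) w \<one>\<^bsub>G\<^esub>"

definition reduced_word :: "('a \<times> bool) list \<Rightarrow> bool" where
  "reduced_word w \<longleftrightarrow> successively (\<lambda>l m. \<not> (fst l = fst m \<and> snd l \<noteq> snd m)) w"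

definition represents :: "('a, 'm) monoid_scheme \<Rightarrow> 'a set \<Rightarrow> ('a \<times> bool) list \<Rightarrow> 'a \<Rightarrow> bool" where
  "represents G X w g \<longleftrightarrow> w \<in> lists (X \<times> UNIV) \<and> reduced_word w \<and> word_val G w = g"

definition free_basis :: "('a, 'm) monoid_scheme \<Rightarrow> 'a set \<Rightarrow> bool" where
  "free_basis G X \<longleftrightarrow> X \<subseteq> carrier G \<and> (\<forall>g\<in>carrier G. \<exists>!w. represents G X w g)"

definition free_group_of_rank :: "('a, 'm) monoid_scheme \<Rightarrow> nat \<Rightarrow> bool" where
  "free_group_of_rank G r \<longleftrightarrow> group G \<and> (\<exists>X. free_basis G X \<and> finite X \<and> card X = r)"

text \<open>Only meaningful when \<open>X\<close> is a free basis of \<open>G\<close> and \<open>g\<close> lies in the carrier.\<close>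

definition word_length :: "('a, 'm) monoid_scheme \<Rightarrow> 'a set \<Rightarrow> 'a \<Rightarrow> nat" where
  "word_length G X g = length (THE w. represents G X w g)"

text \<open>
  The library's \<open>group_action\<close> is a left action; here \<open>act s g\<close> is the image of the point \<open>s\<close>
  under the right action of \<open>g\<close>.
\<close>

definition right_action :: "('a, 'm) monoid_scheme \<Rightarrow> 's set \<Rightarrow> ('s \<Rightarrow> 'a \<Rightarrow> 's) \<Rightarrow> bool" where
  "right_action G S act \<longleftrightarrow>
     (\<forall>s\<in>S. \<forall>g\<in>carrier G. act s g \<in> S) \<and>
     (\<forall>s\<in>S. act s \<one>\<^bsub>G\<^esub> = s) \<and>
     (\<forall>s\<in>S. \<forall>g\<in>carrier G. \<forall>h\<in>carrier G. act s (g \<otimes>\<^bsub>G\<^esub> h) = act (act s g) h)"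

definition transitive_right_action ::
    "('a, 'm) monoid_scheme \<Rightarrow> 's set \<Rightarrow> ('s \<Rightarrow> 'a \<Rightarrow> 's) \<Rightarrow> bool" where
  "transitive_right_action G S act \<longleftrightarrow>
     right_action G S act \<and> S \<noteq> {} \<and> (\<forall>s\<in>S. \<forall>t\<in>S. \<exists>g\<in>carrier G. act s g = t)"

text \<open>
  If \<open>G\<close> has finite rank, then its free bases are finite, so the set counted here is finite.
\<close>

definition growth ::
    "('a, 'm) monoid_scheme \<Rightarrow> 'a set \<Rightarrow> ('s \<Rightarrow> 'a \<Rightarrow> 's) \<Rightarrow> 's \<Rightarrow> nat \<Rightarrow> nat" where
  "growth G X act s n = card {act s g | g. g \<in> carrier G \<and> word_length G X g \<le> n}"

definition growth_equivalent :: "(nat \<Rightarrow> nat) \<Rightarrow> (nat \<Rightarrow> nat) \<Rightarrow> bool" where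
  "growth_equivalent f g \<longleftrightarrow> (\<exists>C C'. \<forall>n. f n \<le> g (n + C) \<and> g n \<le> f (n + C'))"

text \<open>The parameter \<open>r\<close> is the rank of the free group whose growth is considered.\<close>

definition maximal_growth :: "nat \<Rightarrow> (nat \<Rightarrow> nat) \<Rightarrow> bool" where
  "maximal_growth r f \<longleftrightarrow> growth_equivalent f (\<lambda>n. (2 * r - 1) ^ n)"

end

theory Submission
  imports Defs "HOL-Library.Countable_Set"
begin

text \<open>
  Let \<open>a, b\<close> be distinct elements of a free basis \<open>X\<close>, and let \<open>Y\<close> be obtained from \<open>X\<close> by replacing
  \<open>a\<close> by \<open>ab\<close>. A random reduced word of length \<open>n\<close> in \<open>X\<close> has length about \<open>\<kappa>n\<close> in \<open>Y\<close> with
  \<open>\<kappa> > 1\<close>. Let \<open>V\<close> consist of the group elements whose \<open>Y\<close>-length exceeds their \<open>X\<close>-length by at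
  least a small fixed proportion, up to a constant. By an exponential supermartingale, a positive
  proportion of the reduced \<open>X\<close>-words stay in \<open>V\<close> forever, whereas \<open>V\<close> has at most
  \<open>C (2r - 1)\<^bsup>\<theta>n\<^esup>\<close> elements of \<open>Y\<close>-length at most \<open>n\<close>, for some \<open>\<theta> < 1\<close>, because all of these are
  short in \<open>X\<close>.

  The partial action of \<open>F\<close> on \<open>V\<close> by translations is completed to an action on two copies of \<open>V\<close>:
  the letters of \<open>Y\<close> act on the second copy by the opposite translations, and a point whose translate
  would leave \<open>V\<close> is moved to its twin in the other copy. Moving to the twin does not change the
  group element, so a \<open>Y\<close>-ball of the orbit contains only elements of \<open>V\<close> of small \<open>Y\<close>-length.
\<close>

section \<open>Reduced words and actions of a free group\<close>

definition flip :: "'a \<times> bool \<Rightarrow> 'a \<times> bool" where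
  "flip l = (fst l, \<not> snd l)"

text \<open>Left multiplication by a letter on normal forms: a reduced word can cancel only at its
  front. All words below grow at the front, so \<open>tl\<close> undoes the latest step.\<close>

definition cons_reduce :: "'a \<times> bool \<Rightarrow> ('a \<times> bool) list \<Rightarrow> ('a \<times> bool) list" where
  "cons_reduce l w = (if w \<noteq> [] \<and> hd w = flip l then tl w else l # w)"

definition extensions :: "'a set \<Rightarrow> ('a \<times> bool) list \<Rightarrow> ('a \<times> bool) set" where
  "extensions X w = {l \<in> X \<times> UNIV. w = [] \<or> hd w \<noteq> flip l}"

lemma flip_simps [simp]:
  "flip (x, e) = (x, \<not> e)" "fst (flip l) = fst l" "flip (flip l) = l" "flip l \<noteq> l"
  by (simp_all add: flip_def prod_eq_iff)

lemma flip_mem [simp]: "flip l \<in> X \<times> UNIV \<longleftrightarrow> l \<in> X \<times> UNIV"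
  by (cases l) simp

lemma reduced_word_Nil [simp]: "reduced_word []"
  by (simp add: reduced_word_def)

lemma reduced_word_Cons [simp]:
  "reduced_word (l # w) \<longleftrightarrow> reduced_word w \<and> (w = [] \<or> hd w \<noteq> flip l)"
  by (auto simp: reduced_word_def successively_Cons flip_def prod_eq_iff)

lemma reduced_word_cons_reduce: "reduced_word w \<Longrightarrow> reduced_word (cons_reduce l w)"
  by (cases w) (auto simp: cons_reduce_def)

lemma length_cons_reduce: "length (cons_reduce l w) \<le> Suc (length w)"
  by (cases w) (auto simp: cons_reduce_def)

lemma word_val_Nil [simp]: "word_val G [] = \<one>\<^bsub>G\<^esub>"
  by (simp add: word_val_def)

lemma word_val_Cons [simp]: "word_val G (l # w) = letter_val G l \<otimes>\<^bsub>G\<^esub> word_val G w"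
  by (simp add: word_val_def)

context group
begin

lemma letter_val_closed: "X \<subseteq> carrier G \<Longrightarrow> l \<in> X \<times> UNIV \<Longrightarrow> letter_val G l \<in> carrier G"
  by (cases l) (auto simp: letter_val_def)

lemma word_val_closed:
  "X \<subseteq> carrier G \<Longrightarrow> w \<in> lists (X \<times> UNIV) \<Longrightarrow> word_val G w \<in> carrier G"
  by (induction w) (auto intro!: m_closed letter_val_closed[of X])

lemma letter_val_flip:
  "X \<subseteq> carrier G \<Longrightarrow> l \<in> X \<times> UNIV \<Longrightarrow> letter_val G (flip l) = inv (letter_val G l)"
  by (cases l) (auto simp: letter_val_def)

lemma inv_solve_cancel: "x \<in> carrier G \<Longrightarrow> y \<in> carrier G \<Longrightarrow> x \<otimes> (inv x \<otimes> y) = y"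
  by (simp add: m_assoc[symmetric])

lemma inv_solve_cancel': "x \<in> carrier G \<Longrightarrow> y \<in> carrier G \<Longrightarrow> inv x \<otimes> (x \<otimes> y) = y"
  by (simp add: m_assoc[symmetric])

end

locale free_group_basis = group +
  fixes X
  assumes basis: "free_basis G X"
begin

definition nf :: "'a \<Rightarrow> ('a \<times> bool) list" where
  "nf g = (THE w. represents G X w g)"

lemma X_closed: "X \<subseteq> carrier G"
  using basis by (simp add: free_basis_def)

lemmas lv_closed = letter_val_closed[OF X_closed]
lemmas lv_flip = letter_val_flip[OF X_closed]

lemma nf_represents: "g \<in> carrier G \<Longrightarrow> represents G X (nf g) g"
  unfolding nf_def by (rule theI') (use basis in \<open>simp add: free_basis_def\<close>)

lemma nf_eqI:
  assumes "represents G X w g"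
  shows "nf g = w"
proof -
  have "g \<in> carrier G"
    using assms word_val_closed[OF X_closed, of w] by (auto simp: represents_def)
  then have "\<exists>!w. represents G X w g" "represents G X (nf g) g"
    using basis nf_represents by (auto simp: free_basis_def)
  then show ?thesis
    using assms by blast
qed

lemma nf_lists: "g \<in> carrier G \<Longrightarrow> nf g \<in> lists (X \<times> UNIV)"
  and nf_reduced: "g \<in> carrier G \<Longrightarrow> reduced_word (nf g)"
  and word_val_nf: "g \<in> carrier G \<Longrightarrow> word_val G (nf g) = g"
  using nf_represents by (auto simp: represents_def)

lemma nf_word_val: "w \<in> lists (X \<times> UNIV) \<Longrightarrow> reduced_word w \<Longrightarrow> nf (word_val G w) = w"
  by (rule nf_eqI) (auto simp: represents_def)

lemma word_length_eq: "word_length G X g = length (nf g)"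
  by (simp add: word_length_def nf_def)

lemma nf_one [simp]: "nf \<one> = []"
  using nf_word_val[of "[]"] by simp

lemma nf_mult:
  assumes "l \<in> X \<times> UNIV" "g \<in> carrier G"
  shows "nf (letter_val G l \<otimes> g) = cons_reduce l (nf g)"
proof (rule nf_eqI)
  have lv: "letter_val G l \<in> carrier G"
    using assms lv_closed by blast
  have "cons_reduce l (nf g) \<in> lists (X \<times> UNIV)"
    using nf_lists[OF assms(2)] assms(1) by (cases "nf g") (auto simp: cons_reduce_def)
  moreover have "word_val G (cons_reduce l (nf g)) = letter_val G l \<otimes> g"
  proof (cases "nf g \<noteq> [] \<and> hd (nf g) = flip l")
    case True
    then obtain w where w: "nf g = flip l # w"
      by (cases "nf g") auto
    have "w \<in> lists (X \<times> UNIV)"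
      using nf_lists[OF assms(2)] w by simp
    then have "word_val G w \<in> carrier G"
      by (rule word_val_closed[OF X_closed])
    moreover have "g = inv (letter_val G l) \<otimes> word_val G w"
      using word_val_nf[OF assms(2)] w lv_flip[OF assms(1)] by simp
    ultimately show ?thesis
      using w lv by (simp add: cons_reduce_def inv_solve_cancel)
  next
    case False
    then show ?thesis
      using word_val_nf[OF assms(2)] by (auto simp: cons_reduce_def)
  qed
  ultimately show "represents G X (cons_reduce l (nf g)) (letter_val G l \<otimes> g)"
    using reduced_word_cons_reduce[OF nf_reduced[OF assms(2)]] unfolding represents_def by blast
qed

lemma nf_letter: "l \<in> X \<times> UNIV \<Longrightarrow> nf (letter_val G l) = [l]"
  using nf_mult[of l \<one>] lv_closed by (simp add: cons_reduce_def)

lemma basis_induct [consumes 1, case_names one mult]: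
  assumes "g \<in> carrier G"
    and "P \<one>"
    and "\<And>l g. l \<in> X \<times> UNIV \<Longrightarrow> g \<in> carrier G \<Longrightarrow> P g \<Longrightarrow> P (letter_val G l \<otimes> g)"
  shows "P g"
proof -
  have "P (word_val G w)" if "w \<in> lists (X \<times> UNIV)" for w
    using that by (induction w) (use assms word_val_closed[OF X_closed] in auto)
  then show ?thesis
    using nf_lists[OF assms(1)] word_val_nf[OF assms(1)] by fastforce
qed

lemma length_nf_mult:
  assumes "g \<in> carrier G" "h \<in> carrier G"
  shows "length (nf (g \<otimes> h)) \<le> length (nf g) + length (nf h)"
proof -
  have "length (nf (word_val G w \<otimes> h)) \<le> length w + length (nf h)"
    if "w \<in> lists (X \<times> UNIV)" for w
    using that
  proof (induction w)
    case (Cons l w)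
    have "word_val G w \<in> carrier G"
      using Cons.hyps by (intro word_val_closed[OF X_closed])
    then have "nf (word_val G (l # w) \<otimes> h) = cons_reduce l (nf (word_val G w \<otimes> h))"
      using Cons.hyps assms lv_closed by (simp add: m_assoc nf_mult)
    then show ?case
      using Cons length_cons_reduce[of l "nf (word_val G w \<otimes> h)"] by simp
  qed (use assms in simp)
  then show ?thesis
    using nf_lists[OF assms(1)] word_val_nf[OF assms(1)] by fastforce
qed

text \<open>Subadditivity of length avoids describing the reversed word; an upper bound is all that
  is needed to place inverses in balls.\<close>

lemma length_nf_inv:
  "w \<in> lists (X \<times> UNIV) \<Longrightarrow> length (nf (inv (word_val G w))) \<le> length w"
proof (induction w rule: list.induct)
  case (Cons l w)
  then have w: "word_val G w \<in> carrier G" and l: "l \<in> X \<times> UNIV" "letter_val G l \<in> carrier G"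
    using word_val_closed[OF X_closed, of w] lv_closed by auto
  have "inv (word_val G (l # w)) = inv (word_val G w) \<otimes> letter_val G (flip l)"
    using w l lv_flip by (simp add: inv_mult_group)
  moreover have "length (nf (letter_val G (flip l))) = 1"
    using l nf_letter[of "flip l"] by simp
  ultimately show ?case
    using length_nf_mult[of "inv (word_val G w)" "letter_val G (flip l)"] Cons w l lv_flip by simp
qed simp

lemma inj_on_nf: "inj_on nf (carrier G)"
  using word_val_nf by (rule inj_on_inverseI)

section \<open>Actions of the free group built from its letters\<close>

definition run :: "('a \<times> bool \<Rightarrow> 'p \<Rightarrow> 'p) \<Rightarrow> 'p \<Rightarrow> 'a \<Rightarrow> 'p" where
  "run T p g = fold T (nf g) p"

context
  fixes T :: "'a \<times> bool \<Rightarrow> 'p \<Rightarrow> 'p" and P :: "'p set"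
  assumes T_closed: "\<And>l p. l \<in> X \<times> UNIV \<Longrightarrow> p \<in> P \<Longrightarrow> T l p \<in> P"
    and T_flip: "\<And>l p. l \<in> X \<times> UNIV \<Longrightarrow> p \<in> P \<Longrightarrow> T (flip l) (T l p) = p"
begin

text \<open>If \<open>nf g\<close> does not start with \<open>flip l\<close>, the product has normal
  form \<open>l # nf g\<close>. Otherwise \<open>flip l\<close> is dropped, and on the right-hand
  side \<open>T (flip l)\<close> undoes \<open>T l\<close>. Hence letter maps satisfying
  \<open>T_flip\<close> extend to a right action.\<close>

lemma run_letter_mult:
  assumes "l \<in> X \<times> UNIV" "g \<in> carrier G" "p \<in> P"
  shows "run T p (letter_val G l \<otimes> g) = run T (T l p) g"
  using assms T_flip[of l p]
  by (cases "nf g") (auto simp: run_def nf_mult cons_reduce_def)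

lemma run_closed: "g \<in> carrier G \<Longrightarrow> p \<in> P \<Longrightarrow> run T p g \<in> P"
  by (induction g arbitrary: p rule: basis_induct) (simp_all add: run_def[of T _ \<one>] run_letter_mult T_closed)

lemma run_mult:
  assumes "g \<in> carrier G" "h \<in> carrier G" "p \<in> P"
  shows "run T p (g \<otimes> h) = run T (run T p g) h"
  using assms
  by (induction g arbitrary: p rule: basis_induct)
    (simp_all add: run_def[of T _ \<one>] run_letter_mult T_closed m_assoc lv_closed)

lemma run_right_action: "right_action G P (run T)"
  using run_closed run_mult by (auto simp: right_action_def run_def[of T _ \<one>])

end

section \<open>Extending maps of a basis, and Nielsen transformations\<close>

lemma ex_hom_extension:
  assumes "\<phi> \<in> X \<rightarrow> carrier G"
  shows "\<exists>h \<in> hom G G. \<forall>x\<in>X. h x = \<phi> x"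
proof -
  \<comment> \<open>The free group acts on its own carrier, a letter acting by right multiplication
    with its image; the orbit map of \<open>\<one>\<close> is the homomorphism sought.\<close>
  define T where "T = (\<lambda>l p. p \<otimes> letter_val G (\<phi> (fst l), snd l))"
  have lv: "letter_val G (\<phi> (fst l), snd l) \<in> carrier G" if "l \<in> X \<times> UNIV" for l
    using assms that by (intro letter_val_closed[of "\<phi> ` X"]) auto
  have cl: "T l p \<in> carrier G" if "l \<in> X \<times> UNIV" "p \<in> carrier G" for l p
    using that lv unfolding T_def by blast
  have fl: "T (flip l) (T l p) = p" if "l \<in> X \<times> UNIV" "p \<in> carrier G" for l p
  proof -
    have "letter_val G (\<phi> (fst l), \<not> snd l) = inv (letter_val G (\<phi> (fst l), snd l))"
      using letter_val_flip[of "\<phi> ` X" "(\<phi> (fst l), snd l)"] assms that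
      by (simp add: image_subset_iff_funcset mem_Times_iff)
    then show ?thesis
      using that lv by (simp add: T_def m_assoc flip_def)
  qed
  note letter_mult = run_letter_mult[where T = T and P = "carrier G", OF cl fl]
  have rc: "run T \<one> g \<in> carrier G" if "g \<in> carrier G" for g
    using run_closed[where T = T and P = "carrier G", OF cl fl] that by blast
  \<comment> \<open>Right multiplications commute with left translations, so the run from
    \<open>p\<close> is the run from \<open>\<one>\<close> translated by \<open>p\<close>. This
    turns \<open>run_mult\<close> into multiplicativity.\<close>
  have rel: "run T p g = p \<otimes> run T \<one> g" if "g \<in> carrier G" "p \<in> carrier G" for p g
    using that
  proof (induction g arbitrary: p rule: basis_induct)
    case one
    then show ?case by (simp add: run_def)
  next
    case (mult l g)
    have "run T p (letter_val G l \<otimes> g) = run T (T l p) g"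
      using mult.prems mult.hyps by (intro letter_mult)
    also have "\<dots> = T l p \<otimes> run T \<one> g"
      using mult.IH[of "T l p"] mult.prems mult.hyps cl by blast
    also have "\<dots> = p \<otimes> (T l \<one> \<otimes> run T \<one> g)"
      using mult.prems mult.hyps lv rc by (simp add: T_def m_assoc)
    also have "T l \<one> \<otimes> run T \<one> g = run T (T l \<one>) g"
      using mult.IH[of "T l \<one>"] mult.hyps cl by simp
    also have "\<dots> = run T \<one> (letter_val G l \<otimes> g)"
      using letter_mult[of l g \<one>] mult.hyps by simp
    finally show ?case .
  qed
  have "run T \<one> \<in> hom G G"
  proof (rule homI)
    fix g h
    assume gh: "g \<in> carrier G" "h \<in> carrier G"
    show "run T \<one> g \<in> carrier G"
      using rc gh by blast
    then show "run T \<one> (g \<otimes> h) = run T \<one> g \<otimes> run T \<one> h"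
      using run_mult[where T = T and P = "carrier G" and g = g and h = h and p = \<one>, OF cl fl] gh rel[of h "run T \<one> g"] by simp
  qed
  moreover have "run T \<one> x = \<phi> x" if "x \<in> X" for x
  proof -
    have "nf x = [(x, True)]"
      using nf_letter[of "(x, True)"] that by (simp add: letter_val_def)
    then show ?thesis
      using funcset_mem[OF assms that] by (simp add: run_def T_def letter_val_def)
  qed
  ultimately show ?thesis by blast
qed

lemma hom_eq_id:
  assumes "h \<in> hom G G" "\<And>x. x \<in> X \<Longrightarrow> h x = x" "g \<in> carrier G"
  shows "h g = g"
proof -
  interpret h: group_hom G G h
    by unfold_locales (use assms in auto)
  show ?thesis
    using assms(3)
  proof (induction g rule: basis_induct)
    case (mult l g)
    have "h (letter_val G l) = letter_val G l"
      using mult(1) assms(2) X_closed by (cases l) (auto simp: letter_val_def)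
    then show ?case
      using mult lv_closed by simp
  qed simp
qed

text \<open>Applying \<open>h\<close> letterwise is onto the words over the image, preserves and
  reflects reducedness because \<open>h\<close> is injective, and commutes with evaluation; so
  unique representation carries over.\<close>

lemma free_basis_iso_image:
  assumes "h \<in> iso G G"
  shows "free_basis G (h ` X)"
proof -
  have hom: "h \<in> hom G G" and bij: "bij_betw h (carrier G) (carrier G)"
    using assms by (auto simp: iso_def)
  interpret h: group_hom G G h
    by unfold_locales (use hom in auto)
  let ?m = "map (apfst h) :: ('a \<times> bool) list \<Rightarrow> _"
  have inj: "inj_on h (carrier G)"
    using bij by (simp add: bij_betw_def)
  have lv: "letter_val G (apfst h l) = h (letter_val G l)" if "l \<in> X \<times> UNIV" for l
    using that X_closed by (cases l) (auto simp: letter_val_def)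
  have val: "word_val G (?m w) = h (word_val G w)" if "w \<in> lists (X \<times> UNIV)" for w
    using that
  proof (induction w)
    case (Cons l w)
    then show ?case
      using lv[of l] word_val_closed[OF X_closed, of w] lv_closed by simp
  qed simp
  have eq: "apfst h l = flip (apfst h k) \<longleftrightarrow> l = flip k"
    if "l \<in> X \<times> UNIV" "k \<in> X \<times> UNIV" for k l
    using that inj X_closed by (cases l; cases k) (auto dest: inj_onD)
  have red: "reduced_word (?m w) \<longleftrightarrow> reduced_word w" if "w \<in> lists (X \<times> UNIV)" for w
    using that
  proof (induction w)
    case (Cons l w)
    then show ?case
      using eq by (cases w) auto
  qed simp
  have rep: "represents G (h ` X) (?m w) (h g) \<longleftrightarrow> represents G X w g"
    if "w \<in> lists (X \<times> UNIV)" "g \<in> carrier G" for w g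
  proof -
    have "?m w \<in> lists (h ` X \<times> UNIV)"
      using that by force
    moreover have "h (word_val G w) = h g \<longleftrightarrow> word_val G w = g"
      using inj that word_val_closed[OF X_closed, of w] by (auto dest: inj_onD)
    ultimately show ?thesis
      using that by (auto simp: represents_def val red)
  qed
  have surj: "w \<in> ?m ` lists (X \<times> UNIV)" if "w \<in> lists (h ` X \<times> UNIV)" for w
  proof -
    have "h ` X \<times> (UNIV :: bool set) = apfst h ` (X \<times> UNIV)"
      by force
    then show ?thesis
      using that by (simp only: lists_image)
  qed
  show ?thesis
    unfolding free_basis_def
  proof (intro conjI ballI)
    show "h ` X \<subseteq> carrier G"
      using X_closed by auto
    fix g'
    assume "g' \<in> carrier G"
    then obtain g where g: "g \<in> carrier G" "g' = h g"
      using bij by (auto simp: bij_betw_def)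
    show "\<exists>!w. represents G (h ` X) w g'"
    proof (rule ex1I)
      show "represents G (h ` X) (?m (nf g)) g'"
        using g rep nf_lists nf_represents by simp
      fix w
      assume w: "represents G (h ` X) w g'"
      then obtain v where "v \<in> lists (X \<times> UNIV)" "w = ?m v"
        using surj[of w] unfolding represents_def by blast
      then show "w = ?m (nf g)"
        using w g rep nf_eqI by auto
    qed
  qed
qed

text \<open>The substitutions of \<open>a \<otimes> b\<close> and of
  \<open>a \<otimes> inv b\<close> for \<open>a\<close> extend to endomorphisms that are mutually
  inverse, because both composites fix the basis. So the new set is the image of \<open>X\<close>
  under an automorphism.\<close>

lemma nielsen_free_basis:
  assumes "a \<in> X" "b \<in> X" "a \<noteq> b"
  shows "free_basis G (insert (a \<otimes> b) (X - {a}))"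
proof -
  have ab: "a \<in> carrier G" "b \<in> carrier G"
    using assms X_closed by auto
  obtain \<alpha> where \<alpha>: "\<alpha> \<in> hom G G" "\<And>x. x \<in> X \<Longrightarrow> \<alpha> x = (if x = a then a \<otimes> b else x)"
    using ex_hom_extension[of "\<lambda>x. if x = a then a \<otimes> b else x"] ab X_closed by fastforce
  obtain \<beta> where \<beta>: "\<beta> \<in> hom G G" "\<And>x. x \<in> X \<Longrightarrow> \<beta> x = (if x = a then a \<otimes> inv b else x)"
    using ex_hom_extension[of "\<lambda>x. if x = a then a \<otimes> inv b else x"] ab X_closed by fastforce
  interpret \<alpha>: group_hom G G \<alpha>
    by unfold_locales (use \<alpha> in auto)
  interpret \<beta>: group_hom G G \<beta>
    by unfold_locales (use \<beta> in auto)
  have "(\<beta> \<circ> \<alpha>) g = g" if "g \<in> carrier G" for g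
  proof (rule hom_eq_id)
    show "\<beta> \<circ> \<alpha> \<in> hom G G"
      using Group.hom_compose[OF \<alpha>(1) \<beta>(1)] .
  qed (use that assms ab \<alpha>(2) \<beta>(2) in \<open>auto simp: m_assoc\<close>)
  moreover have "(\<alpha> \<circ> \<beta>) g = g" if "g \<in> carrier G" for g
  proof (rule hom_eq_id)
    show "\<alpha> \<circ> \<beta> \<in> hom G G"
      using Group.hom_compose[OF \<beta>(1) \<alpha>(1)] .
  qed (use that assms ab \<alpha>(2) \<beta>(2) in \<open>auto simp: m_assoc\<close>)
  ultimately have "bij_betw \<alpha> (carrier G) (carrier G)"
    by (intro bij_betw_byWitness[where f' = \<beta>]) auto
  then have "free_basis G (\<alpha> ` X)"
    using \<alpha>(1) by (intro free_basis_iso_image) (simp add: iso_def)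
  moreover have "\<alpha> ` X = insert (a \<otimes> b) (X - {a})"
    using assms(1) \<alpha>(2) by (auto simp: image_iff)
  ultimately show ?thesis by simp
qed

end

section \<open>The exponential weight of a word\<close>

text \<open>
  \<open>weight a b w\<close> is \<open>(19/20)\<close> to the power of the \<open>Y\<close>-length of \<open>w\<close>, where \<open>a = (ab) b\<inverse>\<close>: prepending
  \<open>a\<close> or its inverse adds two letters, except that in \<open>a b\<close> and \<open>b\<inverse> a\<inverse>\<close> a pair \<open>b\<inverse> b\<close> cancels.
\<close>

definition step_weight :: "'a \<Rightarrow> 'a \<Rightarrow> 'a \<times> bool \<Rightarrow> ('a \<times> bool) list \<Rightarrow> real" where
  "step_weight a b l w =
     (if fst l = a then (if l = (a, True) \<and> w \<noteq> [] \<and> hd w = (b, True) then 1 else (19/20)\<^sup>2)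
      else if l = (b, False) \<and> w \<noteq> [] \<and> hd w = (a, False) then 20/19 else 19/20)"

primrec weight :: "'a \<Rightarrow> 'a \<Rightarrow> ('a \<times> bool) list \<Rightarrow> real" where
  "weight a b [] = 1"
| "weight a b (l # w) = step_weight a b l w * weight a b w"

text \<open>
  The correction by the first letter that makes \<open>weight\<close> decrease in one step, on average, by a factor
  less than \<open>19/20\<close> whatever the first letter is; it approximates the solution of the associated
  Poisson equation.
\<close>

definition tilt :: "'a \<Rightarrow> 'a \<Rightarrow> ('a \<times> bool) list \<Rightarrow> real" where
  "tilt a b w =
     (if w = [] then 2 else if hd w = (a, False) then 21/20
      else if hd w = (b, True) then 83/80 else 1)"

lemma step_weight_pos: "step_weight a b l w > 0"
  by (simp add: step_weight_def)

lemma weight_pos: "weight a b w > 0"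
  by (induction w) (simp_all add: step_weight_pos)

lemma tilt_ge_1: "tilt a b w \<ge> 1"
  by (simp add: tilt_def)

text \<open>In terms of \<open>Y\<close>-length: prepending one letter of \<open>Y\<close> raises it
  by at most 1. The next two lemmas do the same for \<open>ab\<close> and its inverse, where two
  letters may cancel; hence their splits on the leading letters.\<close>

lemma weight_cons_reduce:
  assumes "reduced_word w" "fst l \<noteq> a"
  shows "19/20 * weight a b w \<le> weight a b (cons_reduce l w)"
  using assms weight_pos[of a b w] weight_pos[of a b "tl w"]
  by (cases w; cases l) (auto simp: cons_reduce_def step_weight_def)

lemma weight_cons_reduce_ab:
  assumes "reduced_word w" "a \<noteq> b"
  shows "19/20 * weight a b w \<le> weight a b (cons_reduce (a, True) (cons_reduce (b, True) w))"
proof (cases w)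
  case Nil
  then show ?thesis
    using assms by (simp add: cons_reduce_def step_weight_def power_divide)
next
  case (Cons l v)
  show ?thesis
  proof (cases v)
    case Nil
    then show ?thesis
      using assms Cons by (auto simp: cons_reduce_def step_weight_def power_divide)
  next
    case (Cons k u)
    then show ?thesis
      using assms \<open>w = l # v\<close> weight_pos[of a b u] weight_pos[of a b "tl u"]
      by (cases l; cases k; cases u) (auto simp: cons_reduce_def step_weight_def power_divide)
  qed
qed

lemma weight_cons_reduce_ba:
  assumes "reduced_word w" "a \<noteq> b"
  shows "19/20 * weight a b w \<le> weight a b (cons_reduce (b, False) (cons_reduce (a, False) w))"
proof (cases w)
  case Nil
  then show ?thesis
    using assms by (simp add: cons_reduce_def step_weight_def power_divide)
next
  case (Cons l v)
  show ?thesis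
  proof (cases v)
    case Nil
    then show ?thesis
      using assms Cons by (auto simp: cons_reduce_def step_weight_def power_divide)
  next
    case (Cons k u)
    then show ?thesis
      using assms \<open>w = l # v\<close> weight_pos[of a b u] weight_pos[of a b "tl u"]
      by (cases l; cases k; cases u) (auto simp: cons_reduce_def step_weight_def power_divide)
  qed
qed

lemma extensions_Cons: "extensions X (l # w) = X \<times> UNIV - {flip l}"
  by (auto simp: extensions_def)

lemma extensions_Nil: "extensions X [] = X \<times> UNIV"
  by (auto simp: extensions_def)

lemma finite_extensions: "finite X \<Longrightarrow> finite (extensions X w)"
  by (rule finite_subset[of _ "X \<times> UNIV"]) (auto simp: extensions_def)

lemma card_extensions:
  assumes "finite X" "w \<in> lists (X \<times> UNIV)"
  shows "card (extensions X w) = (if w = [] then 2 * card X else 2 * card X - 1)"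
proof (cases w)
  case Nil
  then show ?thesis
    using assms by (simp add: extensions_Nil card_cartesian_product)
next
  case (Cons l v)
  then have "flip l \<in> X \<times> UNIV"
    using assms flip_mem[of l X] by auto
  then show ?thesis
    using assms Cons by (simp add: extensions_Cons card_cartesian_product)
qed

lemma sum_step_weight_tilt:
  fixes a b :: 'a
  assumes X: "finite X" "a \<in> X" "b \<in> X" "a \<noteq> b" "w \<in> lists (X \<times> UNIV)"
  defines "m \<equiv> 2 * real (card X) - 1"
  shows "(\<Sum>l\<in>extensions X w. step_weight a b l w * tilt a b (l # w))
    \<le> 19/20 * (m - 1/200) * tilt a b w"
proof -
  \<comment> \<open>Letters other than \<open>a, b\<close> and their inverses contribute exactly \<open>19/20\<close>, so only finitely many
    terms deviate from that value, uniformly in the rank.\<close>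
  let ?E = "extensions X w"
  let ?g = "\<lambda>l. step_weight a b l w * tilt a b (l # w)"
  define D where "D = {(a, True), (a, False), (b, True), (b, False)}"
  have "card {a, b} \<le> card X"
    using X by (intro card_mono) auto
  then have m3: "m \<ge> 3"
    using X(4) by (simp add: m_def)
  have "(\<Sum>l\<in>?E. ?g l - 19/20) = (\<Sum>l\<in>D \<inter> ?E. ?g l - 19/20)"
  proof (rule sum.mono_neutral_right)
    show "\<forall>l\<in>?E - D \<inter> ?E. ?g l - 19/20 = 0"
    proof
      fix l
      assume "l \<in> ?E - D \<inter> ?E"
      then have "fst l \<noteq> a" "fst l \<noteq> b"
        by (cases l; cases "snd l"; simp add: D_def)+
      then show "?g l - 19/20 = 0"
        by (cases l) (simp add: step_weight_def tilt_def)
    qed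
  qed (use finite_extensions[OF X(1)] in auto)
  then have eq: "(\<Sum>l\<in>?E. ?g l) = (\<Sum>l\<in>D \<inter> ?E. ?g l - 19/20) + 19/20 * card ?E"
    by (simp add: sum_subtractf)
  have DX: "D \<subseteq> X \<times> UNIV"
    using X by (auto simp: D_def)
  show ?thesis
  proof (cases w)
    case Nil
    \<comment> \<open>The empty word has one extension more than the others; its \<open>tilt\<close>
      of 2 absorbs the surplus.\<close>
    have c: "real (card ?E) = m + 1"
      using card_extensions[OF X(1,5)] Nil by (simp add: m_def)
    have "D \<inter> ?E = D"
      using Nil DX by (auto simp: extensions_Nil)
    then show ?thesis
      using m3 X(4) unfolding eq c
      by (simp add: Nil D_def step_weight_def tilt_def power_divide algebra_simps)
  next
    case (Cons k v)
    have "card X \<ge> 1"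
      using m3 by (simp add: m_def)
    then have c: "real (card ?E) = m"
      using card_extensions[OF X(1,5)] Cons by (simp add: m_def of_nat_diff)
    have DE: "D \<inter> ?E = D - {flip k}"
      using Cons DX by (auto simp: extensions_Cons)
    consider "k = (a, True)" | "k = (a, False)" | "k = (b, True)" | "k = (b, False)"
      | "fst k \<noteq> a" "fst k \<noteq> b"
      by (cases k) auto
    then show ?thesis
    proof cases
      case 1
      have "D - {flip k} = {(a, True), (b, True), (b, False)}"
        using 1 X(4) by (auto simp: D_def)
      then show ?thesis
        using m3 X(4) unfolding eq c DE
        by (simp add: Cons 1 step_weight_def tilt_def power_divide algebra_simps)
    next
      \<comment> \<open>The tightest case, since prepending the inverse of \<open>b\<close> has
        weight 20/19 here. For rank 2, where \<open>m = 3\<close>, the two sides differ by less than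
        0.002, so the slack 1/200 has little room to grow.\<close>
      case 2
      have "D - {flip k} = {(a, False), (b, True), (b, False)}"
        using 2 X(4) by (auto simp: D_def)
      then show ?thesis
        using m3 X(4) unfolding eq c DE
        by (simp add: Cons 2 step_weight_def tilt_def power_divide algebra_simps)
    next
      case 3
      have "D - {flip k} = {(a, True), (a, False), (b, True)}"
        using 3 X(4) by (auto simp: D_def)
      then show ?thesis
        using m3 X(4) unfolding eq c DE
        by (simp add: Cons 3 step_weight_def tilt_def power_divide algebra_simps)
    next
      case 4
      have "D - {flip k} = {(a, True), (a, False), (b, False)}"
        using 4 X(4) by (auto simp: D_def)
      then show ?thesis
        using m3 X(4) unfolding eq c DE
        by (simp add: Cons 4 step_weight_def tilt_def power_divide algebra_simps)
    next
      case 5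
      have "D - {flip k} = D"
        using 5 by (cases k) (auto simp: D_def)
      moreover have "k \<noteq> (a, e)" "k \<noteq> (b, e)" for e
        using 5 by auto
      ultimately show ?thesis
        using m3 X(4) unfolding eq c DE
        by (simp add: Cons D_def step_weight_def tilt_def power_divide algebra_simps)
    qed
  qed
qed

section \<open>Counting reduced words\<close>

context free_group_basis
begin

definition reduced_words :: "nat \<Rightarrow> ('a \<times> bool) list set" where
  "reduced_words n = {w \<in> lists (X \<times> UNIV). reduced_word w \<and> length w = n}"

lemma reduced_words_0: "reduced_words 0 = {[]}"
  by (auto simp: reduced_words_def)

lemma reduced_words_Suc:
  "reduced_words (Suc n) = (\<lambda>(w, l). l # w) ` (SIGMA w:reduced_words n. extensions X w)"
proof (rule Set.set_eqI)
  fix w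
  show "w \<in> reduced_words (Suc n) \<longleftrightarrow>
      w \<in> (\<lambda>(w, l). l # w) ` (SIGMA w:reduced_words n. extensions X w)"
    by (cases w) (auto simp: reduced_words_def extensions_def image_iff)
qed

lemma finite_reduced_words: "finite X \<Longrightarrow> finite (reduced_words n)"
  by (induction n)
    (auto simp: reduced_words_0 reduced_words_Suc intro!: finite_imageI finite_SigmaI finite_extensions)

lemma card_reduced_words_Suc:
  assumes "finite X"
  shows "card (reduced_words (Suc n)) = 2 * card X * (2 * card X - 1) ^ n"
proof -
  have step: "card (reduced_words (Suc n)) = (\<Sum>w\<in>reduced_words n. card (extensions X w))" for n
    using assms unfolding reduced_words_Suc
    by (subst card_image) (auto simp: inj_on_def finite_reduced_words finite_extensions)
  show ?thesis
  proof (induction n)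
    case 0
    then show ?case
      using assms card_extensions[of X "[]"] by (simp add: step reduced_words_0)
  next
    case (Suc n)
    have "card (extensions X w) = 2 * card X - 1" if "w \<in> reduced_words (Suc n)" for w
      using that assms card_extensions[of X w] unfolding reduced_words_def by auto
    then show ?case
      using step[of "Suc n"] Suc by simp
  qed
qed

definition ball :: "nat \<Rightarrow> 'a set" where
  "ball n = {g \<in> carrier G. length (nf g) \<le> n}"

lemma growth_eq: "growth G X act s n = card (act s ` ball n)"
proof -
  have "{act s g |g. g \<in> carrier G \<and> word_length G X g \<le> n} = act s ` ball n"
    by (auto simp: ball_def word_length_eq)
  then show ?thesis
    by (simp add: growth_def)
qed

lemma ball_words: "nf ` ball n \<subseteq> (\<Union>k\<le>n. reduced_words k)"
  using nf_lists nf_reduced unfolding ball_def reduced_words_def by blast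

lemma finite_ball: "finite X \<Longrightarrow> finite (ball n)"
  using finite_subset[OF ball_words] finite_reduced_words inj_on_subset[OF inj_on_nf, of "ball n"]
  by (metis (no_types, lifting) ball_def finite_UN finite_atMost finite_imageD mem_Collect_eq subsetI)

text \<open>With \<open>M = 2 * card X - 1\<close>, the estimate
  \<open>2 * card X \<le> M * M\<close> bounds the sphere of radius \<open>k\<close> by
  \<open>M ^ (k + 1)\<close>, and summing costs one more factor \<open>M\<close>. Shifts of the
  radius are harmless for \<open>growth_equivalent\<close>.\<close>

lemma card_ball_le:
  assumes "finite X" "card X \<ge> 2"
  shows "card (ball n) \<le> (2 * card X - 1) ^ (n + 2)"
proof -
  define M where "M = 2 * card X - 1"
  have M: "M \<ge> 2" "2 * card X \<le> M * M"
  proof -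
    show "M \<ge> 2"
      using assms by (simp add: M_def)
    then have "2 * M \<le> M * M"
      by (rule mult_le_mono1)
    moreover have "2 * card X = M + 1"
      using assms by (simp add: M_def)
    ultimately show "2 * card X \<le> M * M"
      using \<open>M \<ge> 2\<close> by linarith
  qed
  have words: "card (reduced_words k) \<le> M ^ (k + 1)" for k
  proof (cases k)
    case 0
    then show ?thesis using M by (simp add: reduced_words_0)
  next
    case (Suc j)
    have "2 * card X * M ^ j \<le> M * M * M ^ j"
      using M(2) by (rule mult_le_mono1)
    then show ?thesis
      using card_reduced_words_Suc[OF assms(1)] Suc by (simp add: M_def)
  qed
  have "card (ball n) = card (nf ` ball n)"
    using inj_on_subset[OF inj_on_nf, of "ball n"] by (subst card_image) (auto simp: ball_def)
  also have "\<dots> \<le> card (\<Union>k\<le>n. reduced_words k)"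
    using finite_reduced_words[OF assms(1)] by (intro card_mono ball_words) auto
  also have "\<dots> \<le> (\<Sum>k\<le>n. card (reduced_words k))"
    by (rule card_UN_le) simp
  also have "\<dots> \<le> (\<Sum>k\<le>n. M ^ (k + 1))"
    by (intro sum_mono words)
  also have "\<dots> \<le> M ^ (n + 2)"
  proof (induction n)
    case 0
    then show ?case using M by simp
  next
    case (Suc n)
    have "2 * M ^ (n + 2) \<le> M ^ (Suc n + 2)"
      using mult_le_mono1[OF M(1), of "M ^ (n + 2)"] by (simp only: add_Suc power_Suc)
    moreover have "M ^ (Suc n + 1) = M ^ (n + 2)"
      by simp
    ultimately show ?case
      using Suc.IH unfolding sum.atMost_Suc by linarith
  qed
  finally show ?thesis
    by (simp add: M_def)
qed

lemma growth_le_ball: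
  assumes "finite X" "card X \<ge> 2"
  shows "growth G X act s n \<le> (2 * card X - 1) ^ (n + 2)"
  unfolding growth_eq using card_image_le[OF finite_ball] card_ball_le assms le_trans by blast

text \<open>If \<open>h\<close> carries \<open>s\<close> to \<open>t\<close>, the ball around
  \<open>t\<close> lies in the ball around \<open>s\<close> enlarged by the length of
  \<open>h\<close>.\<close>

lemma growth_shift:
  assumes "finite X" "transitive_right_action G S act" "s \<in> S" "t \<in> S"
  shows "\<exists>C. \<forall>n. growth G X act t n \<le> growth G X act s (n + C)"
proof -
  obtain h where h: "h \<in> carrier G" "act s h = t"
    using assms unfolding transitive_right_action_def by blast
  have "growth G X act t n \<le> growth G X act s (n + length (nf h))" for n
    unfolding growth_eq
  proof (rule card_mono)
    show "finite (act s ` ball (n + length (nf h)))"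
      using assms finite_ball by blast
    show "act t ` ball n \<subseteq> act s ` ball (n + length (nf h))"
    proof
      fix x
      assume "x \<in> act t ` ball n"
      then obtain g where g: "g \<in> carrier G" "length (nf g) \<le> n" "x = act t g"
        by (auto simp: ball_def)
      then have "x = act s (h \<otimes> g)"
        using assms h by (auto simp: transitive_right_action_def right_action_def)
      moreover have "h \<otimes> g \<in> ball (n + length (nf h))"
        using g h length_nf_mult[of h g] by (simp add: ball_def)
      ultimately show "x \<in> act s ` ball (n + length (nf h))"
        by blast
    qed
  qed
  then show ?thesis by blast
qed

lemma countable_carrier:
  assumes "finite X"
  shows "countable (carrier G)"
proof -
  have "carrier G \<subseteq> word_val G ` lists (X \<times> UNIV)"
    using word_val_nf nf_lists by (metis image_eqI subsetI)
  then show ?thesis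
    by (rule countable_subset) (use assms in \<open>simp add: countable_finite\<close>)
qed

end

text \<open>Passing to the orbit of \<open>p\<close> gives transitivity, and numbering the countable
  set \<open>P\<close> injectively preserves the cardinalities. All \<open>Z\<close> are treated at
  once because one action is measured in two bases.\<close>

lemma (in group) ex_transitive_action_on_nat:
  assumes act: "right_action G P A" and P: "countable P" "p \<in> P"
  shows "\<exists>(S :: nat set) act s. transitive_right_action G S act \<and> s \<in> S \<and>
    (\<forall>Z n. growth G Z act s n = growth G Z A p n)"
proof -
  define enc where "enc = to_nat_on P"
  define dec where "dec = from_nat_into P"
  have dec: "dec (enc q) = q" if "q \<in> P" for q
    using that P(1) by (simp add: enc_def dec_def)
  have cl: "A q g \<in> P" if "q \<in> P" "g \<in> carrier G" for q g
    using that act by (simp add: right_action_def)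
  have mult: "A q (g \<otimes> h) = A (A q g) h" if "q \<in> P" "g \<in> carrier G" "h \<in> carrier G" for q g h
    using that act by (simp add: right_action_def)
  have one: "A q \<one> = q" if "q \<in> P" for q
    using that act by (simp add: right_action_def)
  define S where "S = (\<lambda>g. enc (A p g)) ` carrier G"
  define act' where "act' = (\<lambda>s g. enc (A (dec s) g))"
  have act'_enc: "act' (enc (A p g)) h = enc (A p (g \<otimes> h))"
    if "g \<in> carrier G" "h \<in> carrier G" for g h
    using that P cl mult dec by (simp add: act'_def)
  have "transitive_right_action G S act'"
    unfolding transitive_right_action_def right_action_def
  proof (intro conjI ballI)
    fix s g h
    assume "s \<in> S" and gh: "g \<in> carrier G" "h \<in> carrier G"
    then obtain k where k: "k \<in> carrier G" "s = enc (A p k)"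
      by (auto simp: S_def)
    show "act' s g \<in> S"
      using k gh act'_enc by (auto simp: S_def)
    show "act' s (g \<otimes> h) = act' (act' s g) h"
      using k gh act'_enc by (simp add: m_assoc)
  next
    fix s
    assume "s \<in> S"
    then show "act' s \<one> = s"
      using act'_enc by (auto simp: S_def)
  next
    show "S \<noteq> {}"
      by (auto simp: S_def)
  next
    fix s t
    assume "s \<in> S" "t \<in> S"
    then obtain g h where gh: "g \<in> carrier G" "s = enc (A p g)" "h \<in> carrier G" "t = enc (A p h)"
      by (auto simp: S_def)
    then have "act' s (inv g \<otimes> h) = t"
      using act'_enc by (simp add: inv_solve_cancel)
    then show "\<exists>g\<in>carrier G. act' s g = t"
      using gh by blast
  qed
  moreover have "enc p \<in> S"
    using one[OF P(2)] by (force simp: S_def)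
  moreover have "growth G Z act' (enc p) n = growth G Z A p n" for Z n
  proof -
    let ?B = "{A p g |g. g \<in> carrier G \<and> word_length G Z g \<le> n}"
    have "{act' (enc p) g |g. g \<in> carrier G \<and> word_length G Z g \<le> n} = enc ` ?B"
      using dec[OF P(2)] by (auto simp: act'_def)
    moreover have "inj_on enc ?B"
      using dec cl P(2) by (intro inj_on_inverseI[of _ dec]) auto
    ultimately show ?thesis
      by (simp add: growth_def card_image)
  qed
  ultimately show ?thesis by blast
qed

lemma eventually_power_le:
  fixes C x y :: real
  assumes "0 < x" "x < y"
  shows "\<forall>\<^sub>F n in sequentially. C * x ^ n \<le> y ^ n"
proof -
  have "(\<lambda>n. C * (x / y) ^ n) \<longlonglongrightarrow> C * 0"
    using assms by (intro tendsto_intros LIMSEQ_realpow_zero) auto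
  then have "\<forall>\<^sub>F n in sequentially. C * (x / y) ^ n < 1"
    by (rule order_tendstoD(2)) simp
  then show ?thesis
    by eventually_elim (use assms in \<open>simp add: power_divide divide_simps\<close>)
qed

section \<open>The action attached to a Nielsen move\<close>

locale nielsen_pair = free_group_basis +
  fixes a b
  assumes finite_X: "finite X" and a_in: "a \<in> X" and b_in: "b \<in> X" and a_neq_b: "a \<noteq> b"
begin

lemma card_X: "card X \<ge> 2"
  using card_mono[of X "{a, b}"] finite_X a_in b_in a_neq_b by simp

definition m :: real where
  "m = 2 * real (card X) - 1"

text \<open>Chosen so that the drift bound of \<open>sum_step_weight_tilt\<close>, multiplied by
  \<open>rho\<close>, becomes exactly the factor \<open>m\<close>; the slack 1/200 is what makes it
  exceed 20/19.\<close>

definition rho :: real where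
  "rho = m / (19/20 * (m - 1/200))"

lemma m_ge_3: "m \<ge> 3"
  using card_X by (simp add: m_def)

lemma rho_gt: "rho > 20/19" "rho > 1"
proof -
  show "rho > 20/19"
    using m_ge_3 by (simp add: rho_def divide_simps)
  then show "rho > 1" by simp
qed

definition potential :: "('a \<times> bool) list \<Rightarrow> real" where
  "potential w = weight a b w * rho ^ length w * tilt a b w"

lemma potential_pos: "potential w > 0"
  using weight_pos[of a b w] tilt_ge_1[of a b w] rho_gt by (simp add: potential_def)

text \<open>The supermartingale inequality: for nonempty \<open>w\<close> the average of
  \<open>potential\<close> over the \<open>m\<close> extensions is at most its present
  value.\<close>

lemma sum_potential_le:
  assumes "w \<in> lists (X \<times> UNIV)"
  shows "(\<Sum>l\<in>extensions X w. potential (l # w)) \<le> m * potential w"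
proof -
  let ?c = "weight a b w * rho ^ length w * rho"
  have "(\<Sum>l\<in>extensions X w. potential (l # w)) =
      ?c * (\<Sum>l\<in>extensions X w. step_weight a b l w * tilt a b (l # w))"
    by (simp add: potential_def sum_distrib_left mult_ac)
  also have "\<dots> \<le> ?c * (19/20 * (m - 1/200) * tilt a b w)"
    using sum_step_weight_tilt[OF finite_X a_in b_in a_neq_b assms] weight_pos[of a b w] rho_gt
    by (intro mult_left_mono) (auto simp: m_def)
  also have "\<dots> = m * potential w"
    using m_ge_3 by (simp add: potential_def rho_def)
  finally show ?thesis .
qed

text \<open>
  All suffixes of a good word have potential below 4. Dropping an extension \<open>l # w\<close> with potential at
  least 4 discards a nonpositive term of \<open>\<Sum> (1 - potential / 4)\<close>, which is how optional stopping
  appears in \<open>card_good_ge\<close>.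
\<close>

primrec good :: "nat \<Rightarrow> ('a \<times> bool) list set" where
  "good 0 = {[]}"
| "good (Suc n) = (\<lambda>(w, l). l # w) ` (SIGMA w:good n. {l \<in> extensions X w. potential (l # w) < 4})"

lemma good_subset: "good n \<subseteq> reduced_words n"
  by (induction n) (auto simp: reduced_words_0 reduced_words_Suc)

lemma potential_good: "w \<in> good n \<Longrightarrow> potential w < 4"
  by (cases n) (auto simp: potential_def tilt_def)

lemma finite_good: "finite (good n)"
  using good_subset finite_reduced_words[OF finite_X] by (rule finite_subset)

lemma card_good_ge: "m ^ n / 2 \<le> card (good n)"
proof -
  \<comment> \<open>The induction runs on this sum rather than on the cardinality. The empty word
    has potential 2, so the sum starts at 1 - 2/4, the source of the factor 1/2.\<close>
  have "m ^ n / 2 \<le> (\<Sum>w\<in>good n. 1 - potential w / 4)"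
  proof (induction n)
    case 0
    then show ?case by (simp add: potential_def tilt_def)
  next
    case (Suc n)
    let ?F = "\<lambda>w. {l \<in> extensions X w. potential (l # w) < 4}"
    have step: "m * (1 - potential w / 4) \<le> (\<Sum>l\<in>?F w. 1 - potential (l # w) / 4)"
      if "w \<in> good n" for w
    proof -
      have w: "w \<in> lists (X \<times> UNIV)"
        using that good_subset unfolding reduced_words_def by blast
      have "m \<le> card (extensions X w)"
        using card_extensions[OF finite_X w] card_X by (auto simp: m_def)
      then have "m * (1 - potential w / 4) \<le> (\<Sum>l\<in>extensions X w. 1 - potential (l # w) / 4)"
        using sum_potential_le[OF w]
        by (simp add: sum_subtractf sum_divide_distrib[symmetric] algebra_simps)
      also have "\<dots> \<le> (\<Sum>l\<in>?F w. 1 - potential (l # w) / 4)"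
      proof -
        have "(\<Sum>l\<in>extensions X w - ?F w. 1 - potential (l # w) / 4) \<le> 0"
          by (rule sum_nonpos) auto
        then show ?thesis
          using sum.subset_diff[of "?F w" "extensions X w" "\<lambda>l. 1 - potential (l # w) / 4"]
            finite_extensions[OF finite_X, of w] by auto
      qed
      finally show ?thesis .
    qed
    have "m ^ Suc n / 2 \<le> m * (\<Sum>w\<in>good n. 1 - potential w / 4)"
      using Suc m_ge_3 by simp
    also have "\<dots> \<le> (\<Sum>w\<in>good n. \<Sum>l\<in>?F w. 1 - potential (l # w) / 4)"
      unfolding sum_distrib_left by (intro sum_mono step)
    also have "\<dots> = (\<Sum>w\<in>good (Suc n). 1 - potential w / 4)"
      using finite_good finite_extensions[OF finite_X]
      by (simp, subst sum.reindex) (auto simp: inj_on_def sum.Sigma split_def)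
    finally show ?case .
  qed
  also have "\<dots> \<le> (\<Sum>w\<in>good n. 1)"
    using potential_pos by (intro sum_mono) (simp add: less_imp_le)
  finally show ?thesis by simp
qed

end

section \<open>The action on two copies of the core\<close>

context nielsen_pair
begin

definition Y :: "'a set" where
  "Y = insert (a \<otimes> b) (X - {a})"

definition wt :: "'a \<Rightarrow> real" where
  "wt g = weight a b (nf g)"

text \<open>
  The factor \<open>rho\<^sup>2 * (20/19)\<close> leaves room for one \<open>Y\<close>-step beyond the elements represented by good words.
\<close>

definition core :: "'a set" where
  "core = {g \<in> carrier G. wt g * rho ^ length (nf g) \<le> 4 * rho\<^sup>2 * (20/19)}"

text \<open>
  For a right action the letter \<open>l\<close> translates on the left by its inverse; on the second copy
  (\<open>snd p = True\<close>) it translates by \<open>l\<close> itself, which makes \<open>move l\<close> a bijection.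
\<close>

definition move :: "'a \<times> bool \<Rightarrow> 'a \<times> bool \<Rightarrow> 'a \<times> bool" where
  "move l p =
     (let u = (if snd p then letter_val G l else inv (letter_val G l)) \<otimes> fst p
      in if u \<in> core then (u, snd p) else (fst p, \<not> snd p))"

lemma ab_closed: "a \<in> carrier G" "b \<in> carrier G"
  using a_in b_in X_closed by auto

lemma free_basis_Y: "free_basis G Y"
  unfolding Y_def using a_in b_in a_neq_b by (rule nielsen_free_basis)

interpretation Y: free_group_basis G Y
  by unfold_locales (rule free_basis_Y)

lemma finite_Y: "finite Y"
  using finite_X by (simp add: Y_def)

lemma wt_pos: "wt g > 0"
  by (simp add: wt_def weight_pos)

lemma Y_letter_cases:
  assumes "l \<in> Y \<times> UNIV"
  obtains (old) "l \<in> X \<times> UNIV" "fst l \<noteq> a"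
    | (ab) "letter_val G l = letter_val G (a, True) \<otimes> letter_val G (b, True)"
    | (ba) "letter_val G l = letter_val G (b, False) \<otimes> letter_val G (a, False)"
  using assms ab_closed
  by (cases l; cases "snd l") (auto simp: Y_def letter_val_def inv_mult_group)

lemma Y_letter_mult:
  assumes "l \<in> Y \<times> UNIV" "g \<in> carrier G"
  shows "19/20 * wt g \<le> wt (letter_val G l \<otimes> g)"
    and "length (nf (letter_val G l \<otimes> g)) \<le> length (nf g) + 2"
proof -
  have two: "nf (letter_val G k \<otimes> letter_val G k' \<otimes> g) = cons_reduce k (cons_reduce k' (nf g))"
    if "k \<in> X \<times> UNIV" "k' \<in> X \<times> UNIV" for k k'
    using that assms(2) lv_closed by (simp add: m_assoc nf_mult)
  have len: "length (cons_reduce k (cons_reduce k' w)) \<le> length w + 2" for k k' :: "'a \<times> bool" and w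
    using length_cons_reduce[of k "cons_reduce k' w"] length_cons_reduce[of k' w] by linarith
  note red = nf_reduced[OF assms(2)]
  have "19/20 * wt g \<le> wt (letter_val G l \<otimes> g) \<and>
      length (nf (letter_val G l \<otimes> g)) \<le> length (nf g) + 2"
    using assms(1)
  proof (cases l rule: Y_letter_cases)
    case old
    then show ?thesis
      using weight_cons_reduce[OF red] assms(2) length_cons_reduce[of l "nf g"]
      by (simp add: wt_def nf_mult)
  next
    case ab
    then show ?thesis
      using weight_cons_reduce_ab[OF red a_neq_b] two[of "(a, True)" "(b, True)"] len a_in b_in
      by (simp add: wt_def)
  next
    case ba
    then show ?thesis
      using weight_cons_reduce_ba[OF red a_neq_b] two[of "(b, False)" "(a, False)"] len a_in b_in
      by (simp add: wt_def)
  qed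
  then show "19/20 * wt g \<le> wt (letter_val G l \<otimes> g)"
    and "length (nf (letter_val G l \<otimes> g)) \<le> length (nf g) + 2"
    by auto
qed

lemma core_closed: "core \<subseteq> carrier G"
  by (auto simp: core_def)

lemma move_closed: "l \<in> Y \<times> UNIV \<Longrightarrow> p \<in> core \<times> UNIV \<Longrightarrow> move l p \<in> core \<times> UNIV"
  by (auto simp: move_def Let_def)

text \<open>If \<open>move l\<close> switches copies at \<open>p\<close>, then \<open>flip l\<close>
  on the twin attempts the same translation, which again leaves \<open>core\<close>, so it switches
  back.\<close>

lemma move_flip:
  assumes "l \<in> Y \<times> UNIV" "p \<in> core \<times> UNIV"
  shows "move (flip l) (move l p) = p"
proof -
  have "letter_val G l \<in> carrier G" "fst p \<in> carrier G"
    using assms core_closed Y.lv_closed by auto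
  then show ?thesis
    using assms Y.lv_flip[OF assms(1)]
    by (cases p) (auto simp: move_def Let_def inv_solve_cancel inv_solve_cancel')
qed

abbreviation act :: "'a \<times> bool \<Rightarrow> 'a \<Rightarrow> 'a \<times> bool" where
  "act \<equiv> Y.run move"

lemmas act_right_action = Y.run_right_action[where T = move, OF move_closed move_flip]

lemma act_letter: "l \<in> Y \<times> UNIV \<Longrightarrow> act p (letter_val G l) = move l p"
  by (simp add: Y.run_def Y.nf_letter)

lemma act_mult:
  "p \<in> core \<times> UNIV \<Longrightarrow> g \<in> carrier G \<Longrightarrow> h \<in> carrier G \<Longrightarrow> act p (g \<otimes> h) = act (act p g) h"
  using act_right_action unfolding right_action_def by blast

lemma act_one: "act p \<one> = p"
  by (simp add: Y.run_def)

lemma wt_move: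
  assumes "l \<in> Y \<times> UNIV" "p \<in> core \<times> UNIV"
  shows "19/20 * wt (fst p) \<le> wt (fst (move l p))"
proof -
  have "fst p \<in> carrier G"
    using assms(2) core_closed by auto
  then have "19/20 * wt (fst p) \<le> wt (letter_val G l \<otimes> fst p)"
    and "19/20 * wt (fst p) \<le> wt (inv (letter_val G l) \<otimes> fst p)"
    using Y_letter_mult(1)[of l] Y_letter_mult(1)[of "flip l"] assms(1) Y.lv_flip[OF assms(1)] by auto
  moreover have "19/20 * wt (fst p) \<le> wt (fst p)"
    using wt_pos[of "fst p"] by simp
  ultimately show ?thesis
    by (simp add: move_def Let_def)
qed

text \<open>Each letter of \<open>Y\<close> costs at most a factor 19/20, whether it translates or
  switches copies, since a switch keeps the group element.\<close>

lemma wt_act: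
  assumes "g \<in> carrier G" "p \<in> core \<times> UNIV"
  shows "(19/20) ^ length (Y.nf g) * wt (fst p) \<le> wt (fst (act p g))"
proof -
  have "(19/20) ^ length w * wt (fst p) \<le> wt (fst (fold move w p))"
    if "w \<in> lists (Y \<times> UNIV)" for w
    using that assms(2)
  proof (induction w arbitrary: p)
    case Nil
    then show ?case by simp
  next
    case (Cons l w)
    have "(19/20) ^ length (l # w) * wt (fst p) \<le> (19/20) ^ length w * wt (fst (move l p))"
      using wt_move[of l p] Cons by simp
    also have "\<dots> \<le> wt (fst (fold move w (move l p)))"
      using Cons move_closed by blast
    finally show ?case by simp
  qed
  then show ?thesis
    using Y.nf_lists[OF assms(1)] by (simp add: Y.run_def)
qed

text \<open>The inverse letter leads from \<open>?v\<close> back to \<open>u\<close>, so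
  \<open>wt\<close> grows by at most 20/19, while the \<open>X\<close>-length grows by at most 2.
  These are exactly the extra factors allowed in \<open>core\<close>.\<close>

lemma near_core:
  assumes "u \<in> carrier G" "wt u * rho ^ length (nf u) < 4" "l \<in> Y \<times> UNIV"
  shows "letter_val G l \<otimes> u \<in> core"
proof -
  let ?v = "letter_val G l \<otimes> u"
  have l: "letter_val G l \<in> carrier G"
    using assms Y.lv_closed by blast
  have "flip l \<in> Y \<times> UNIV" "letter_val G (flip l) \<otimes> ?v = u"
    using assms l Y.lv_flip[OF assms(3)] by (auto simp: inv_solve_cancel')
  then have "19/20 * wt ?v \<le> wt u"
    using Y_letter_mult(1)[of "flip l" ?v] assms(1) l by simp
  moreover have "rho ^ length (nf ?v) \<le> rho ^ length (nf u) * rho\<^sup>2"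
    unfolding power_add[symmetric]
    by (rule power_increasing[OF Y_letter_mult(2)[OF assms(3,1)] less_imp_le[OF rho_gt(2)]])
  ultimately have "(19/20 * wt ?v) * rho ^ length (nf ?v) \<le> wt u * (rho ^ length (nf u) * rho\<^sup>2)"
    using wt_pos rho_gt by (intro mult_mono) (auto simp: less_imp_le)
  also have "\<dots> \<le> 4 * rho\<^sup>2"
    using mult_right_mono[of "wt u * rho ^ length (nf u)" 4 "rho\<^sup>2"] assms(2) by (simp add: mult_ac)
  finally show ?thesis
    using assms(1) l by (simp add: core_def)
qed

lemma wt_good:
  assumes "w \<in> good n"
  shows "word_val G w \<in> carrier G"
    and "wt (word_val G w) * rho ^ length (nf (word_val G w)) < 4"
    and "word_val G w \<in> core"
proof -
  have w: "w \<in> lists (X \<times> UNIV)" "reduced_word w"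
    using assms good_subset unfolding reduced_words_def by auto
  then have nf: "nf (word_val G w) = w"
    by (rule nf_word_val)
  show cl: "word_val G w \<in> carrier G"
    using w word_val_closed X_closed by blast
  have "weight a b w * rho ^ length w \<le> potential w"
    using tilt_ge_1[of a b w] weight_pos[of a b w] rho_gt by (simp add: potential_def)
  then show lt: "wt (word_val G w) * rho ^ length (nf (word_val G w)) < 4"
    using potential_good[OF assms] by (simp add: nf wt_def)
  have "4 * 1 \<le> 4 * rho\<^sup>2 * (20/19)"
    using one_le_power[OF less_imp_le[OF rho_gt(2)], of 2] by simp
  then show "word_val G w \<in> core"
    using lt cl by (simp add: core_def)
qed

text \<open>
  An \<open>X\<close>-letter \<open>a\<close> is the product of two \<open>Y\<close>-letters; the intermediate point lies in \<open>core\<close> by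
  \<open>near_core\<close>, so the path never switches to the second copy.
\<close>

lemma act_good:
  "w \<in> good n \<Longrightarrow> act (\<one>, False) (inv (word_val G w)) = (word_val G w, False)"
proof (induction n arbitrary: w)
  case 0
  then show ?case by (simp add: act_one)
next
  case (Suc n)
  then obtain v l where w: "w = l # v" "v \<in> good n" "l \<in> X \<times> UNIV"
    by (auto simp: extensions_def)
  define u where "u = word_val G v"
  define s where "s = letter_val G l"
  have u: "u \<in> carrier G" "wt u * rho ^ length (nf u) < 4" "u \<in> core"
    using wt_good[OF w(2)] by (auto simp: u_def)
  have s: "s \<in> carrier G"
    using w(3) lv_closed by (auto simp: s_def)
  have su: "s \<otimes> u \<in> core"
    using wt_good(3)[OF Suc.prems] w by (simp add: s_def u_def)
  have one: "(\<one>, False) \<in> core \<times> UNIV"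
    using wt_good(3)[of "[]" 0] by simp
  have b: "(b, e) \<in> Y \<times> UNIV" and ab: "(a \<otimes> b, e) \<in> Y \<times> UNIV" for e
    using b_in a_neq_b by (auto simp: Y_def)
  have act_two: "act (u, False) (letter_val G k \<otimes> letter_val G k') = move k' (move k (u, False))"
    if "k \<in> Y \<times> UNIV" "k' \<in> Y \<times> UNIV" for k k'
    using that u act_mult[of "(u, False)"] act_letter Y.lv_closed by simp
  have "act (u, False) (inv s) = (s \<otimes> u, False)"
  proof (cases "fst l = a")
    case False
    then have "flip l \<in> Y \<times> UNIV" "letter_val G (flip l) = inv s"
      using w(3) lv_flip[OF w(3)] by (auto simp: Y_def s_def mem_Times_iff)
    then show ?thesis
      using act_letter[of "flip l"] su s by (simp add: move_def)
  next
    case True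
    show ?thesis
    proof (cases "snd l")
      case True
      then have s_eq: "s = a"
        using \<open>fst l = a\<close> by (simp add: s_def letter_val_def)
      \<comment> \<open>The path is \<open>u\<close>, \<open>inv b \<otimes> u\<close>,
        \<open>a \<otimes> u\<close>.\<close>
      have "inv b \<otimes> u \<in> core"
        using near_core[OF u(1,2) b[of False]] by (simp add: letter_val_def)
      moreover have "a \<otimes> b \<otimes> (inv b \<otimes> u) = a \<otimes> u"
        using ab_closed u(1) by (simp add: m_assoc inv_solve_cancel)
      moreover have "inv s = letter_val G (b, True) \<otimes> letter_val G (a \<otimes> b, False)"
        using ab_closed by (simp add: s_eq letter_val_def inv_mult_group inv_solve_cancel)
      ultimately show ?thesis
        using act_two[OF b[of True] ab[of False]] su ab_closed
        by (simp add: move_def letter_val_def s_eq)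
    next
      case False
      then have s_eq: "s = inv a"
        using \<open>fst l = a\<close> by (simp add: s_def letter_val_def)
      \<comment> \<open>The path is \<open>u\<close>,
        \<open>inv (a \<otimes> b) \<otimes> u\<close>, \<open>inv a \<otimes> u\<close>.\<close>
      have "inv (a \<otimes> b) \<otimes> u \<in> core"
        using near_core[OF u(1,2) ab[of False]] by (simp add: letter_val_def)
      moreover have "b \<otimes> (inv (a \<otimes> b) \<otimes> u) = inv a \<otimes> u"
        using ab_closed u(1) by (simp add: inv_mult_group m_assoc inv_solve_cancel)
      moreover have "inv s = letter_val G (a \<otimes> b, True) \<otimes> letter_val G (b, False)"
        using ab_closed by (simp add: s_eq letter_val_def m_assoc)
      ultimately show ?thesis
        using act_two[OF ab[of True] b[of False]] su ab_closed
        by (simp add: move_def letter_val_def s_eq)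
    qed
  qed
  moreover have "act (\<one>, False) (inv u) = (u, False)"
    using Suc.IH[OF w(2)] by (simp add: u_def)
  moreover have "inv (word_val G w) = inv u \<otimes> inv s"
    using u s by (simp add: w u_def[symmetric] s_def[symmetric] inv_mult_group)
  moreover have "word_val G w = s \<otimes> u"
    by (simp add: w u_def s_def)
  moreover have "act (\<one>, False) (inv u \<otimes> inv s) = act (act (\<one>, False) (inv u)) (inv s)"
    using act_mult[OF one] u s by blast
  ultimately show ?case by simp
qed

section \<open>Growth in the two bases\<close>

lemma growth_X_ge: "m ^ n \<le> growth G X act (\<one>, False) (n + 1)"
proof -
  let ?f = "\<lambda>w. (word_val G w, False)"
  have nf: "nf (word_val G w) = w" and len: "length w = n + 1" and w: "w \<in> lists (X \<times> UNIV)"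
    if "w \<in> good (n + 1)" for w
  proof -
    have "w \<in> reduced_words (n + 1)"
      using that good_subset by blast
    then show "nf (word_val G w) = w" "length w = n + 1" "w \<in> lists (X \<times> UNIV)"
      using nf_word_val[of w] unfolding reduced_words_def by auto
  qed
  \<comment> \<open>The extra unit of radius pays for the factor 1/2 in
    \<open>card_good_ge\<close>.\<close>
  have "m ^ n \<le> m ^ (n + 1) / 2"
    using m_ge_3 by simp
  also have "\<dots> \<le> card (good (n + 1))"
    by (rule card_good_ge)
  also have "card (good (n + 1)) = card (?f ` good (n + 1))"
    by (subst card_image) (auto intro!: inj_on_inverseI[of _ "\<lambda>p. nf (fst p)"] simp: nf simp del: good.simps)
  also have "\<dots> \<le> card (act (\<one>, False) ` ball (n + 1))"
  proof (rule card_mono)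
    show "finite (act (\<one>, False) ` ball (n + 1))"
      using finite_ball[OF finite_X] by blast
    show "?f ` good (n + 1) \<subseteq> act (\<one>, False) ` ball (n + 1)"
    proof
      fix p
      assume "p \<in> ?f ` good (n + 1)"
      then obtain v where v: "v \<in> good (n + 1)" "p = (word_val G v, False)"
        by blast
      have "inv (word_val G v) \<in> ball (n + 1)"
        using wt_good(1)[OF v(1)] length_nf_inv[OF w[OF v(1)]] len[OF v(1)] by (simp add: ball_def)
      then show "p \<in> act (\<one>, False) ` ball (n + 1)"
        using act_good[OF v(1)] v(2) by force
    qed
  qed
  finally show ?thesis
    by (simp add: growth_eq)
qed

text \<open>After \<open>n\<close> steps \<open>wt\<close> is still at least
  \<open>(19/20) ^ n\<close>, while \<open>core\<close> bounds \<open>wt\<close> times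
  \<open>rho\<close> to the \<open>X\<close>-length by \<open>K\<close>. Taking logarithms, the
  \<open>X\<close>-length is at most \<open>\<theta> * n + D\<close>, with
  \<open>\<theta> < 1\<close> because \<open>rho > 20/19\<close>. So the \<open>Y\<close>-ball of
  the orbit lies in two copies of a smaller \<open>X\<close>-ball, and
  \<open>m powr \<theta>\<close> serves as \<open>x\<close>.\<close>

lemma growth_Y_le: 
  "\<exists>(C::real) (x::real). 0 < x \<and> x < m \<and> (\<forall>n. real (growth G Y act (\<one>, False) n) \<le> C * x ^ n)"
proof -
  define K where "K = 4 * rho\<^sup>2 * (20/19)"
  define \<theta> where "\<theta> = ln (20/19) / ln rho"
  define D where "D = ln K / ln rho"
  have rho1: "1 < rho" and lnrho: "ln rho > 0"
    using rho_gt by simp_all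
  have K: "K > 0"
    using rho_gt by (simp add: K_def)
  have one: "(\<one>, False) \<in> core \<times> UNIV"
    using wt_good(3)[of "[]" 0] by simp
  have \<theta>: "0 < \<theta>" "\<theta> < 1"
    using rho_gt lnrho by (simp_all add: \<theta>_def)
  have len: "length (nf v) \<le> \<theta> * n + D" if "v \<in> core" "(19/20) ^ n \<le> wt v" for v n
  proof -
    have "(19/20) ^ n * rho ^ length (nf v) \<le> wt v * rho ^ length (nf v)"
      using that(2) rho1 by (intro mult_right_mono) auto
    also have "\<dots> \<le> K"
      using that(1) by (simp add: core_def K_def)
    finally have "ln ((19/20) ^ n * rho ^ length (nf v)) \<le> ln K"
      using K rho1 by simp
    moreover have "ln ((19/20) ^ n * rho ^ length (nf v)) =
        length (nf v) * ln rho - n * ln (20/19 :: real)"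
      using rho1 by (simp add: ln_mult ln_realpow ln_div algebra_simps)
    ultimately have "length (nf v) * ln rho \<le> n * ln (20/19) + ln K"
      by simp
    then show ?thesis
      using lnrho by (simp add: \<theta>_def D_def field_simps)
  qed
  let ?C = "2 * m powr (D + 2)"
  have bound: "real (growth G Y act (\<one>, False) n) \<le> ?C * (m powr \<theta>) ^ n" for n
  proof -
    define L where "L = nat \<lfloor>\<theta> * n + D\<rfloor>"
    have sub: "act (\<one>, False) ` Y.ball n \<subseteq> ball L \<times> UNIV"
    proof
      fix p
      assume "p \<in> act (\<one>, False) ` Y.ball n"
      then obtain g where g: "g \<in> carrier G" "length (Y.nf g) \<le> n" "p = act (\<one>, False) g"
        by (auto simp: Y.ball_def)
      have p: "p \<in> core \<times> UNIV"
        using act_right_action g one unfolding right_action_def by blast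
      have "(19/20) ^ n \<le> ((19/20) ^ length (Y.nf g) :: real)"
        using g(2) by (intro power_decreasing) auto
      also have "\<dots> \<le> wt (fst p)"
        using wt_act[OF g(1) one] by (simp add: g(3) wt_def)
      finally have "real (length (nf (fst p))) \<le> \<theta> * n + D"
        using len p by auto
      then have "length (nf (fst p)) \<le> L"
        unfolding L_def by linarith
      then show "p \<in> ball L \<times> UNIV"
        using p core_closed by (auto simp: ball_def)
    qed
    \<comment> \<open>Applied to \<open>\<one>\<close>, the length bound shows that
      \<open>\<theta> * n + D\<close> is nonnegative, so \<open>nat\<close> does not round it up in
      \<open>L\<close>.\<close>
    have "length (nf \<one>) \<le> \<theta> * n + D"
      using one by (intro len) (auto simp: wt_def power_le_one)
    then have L: "real L \<le> \<theta> * n + D"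
      unfolding L_def by simp
    have "growth G Y act (\<one>, False) n \<le> card (ball L \<times> (UNIV :: bool set))"
      unfolding Y.growth_eq using finite_ball[OF finite_X] sub by (intro card_mono) auto
    also have "\<dots> \<le> 2 * (2 * card X - 1) ^ (L + 2)"
      using card_ball_le[OF finite_X card_X, of L] by (simp add: card_cartesian_product)
    finally have "real (growth G Y act (\<one>, False) n) \<le> real (2 * (2 * card X - 1) ^ (L + 2))"
      by (rule of_nat_mono)
    also have "\<dots> = 2 * m ^ (L + 2)"
      using card_X by (simp add: m_def of_nat_diff)
    also have "\<dots> = 2 * m powr (L + 2)"
      using m_ge_3 by (subst powr_realpow) auto
    also have "\<dots> \<le> 2 * m powr ((\<theta> * n + D) + 2)"
      using L m_ge_3 by (intro mult_left_mono powr_mono) auto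
    also have "\<dots> = ?C * (m powr \<theta>) ^ n"
      using m_ge_3 by (simp add: powr_add powr_powr[symmetric] powr_realpow)
    finally show ?thesis .
  qed
  have "m powr \<theta> < m powr 1"
    using \<theta> m_ge_3 by (intro powr_less_mono) auto
  then have "m powr \<theta> < m"
    using m_ge_3 by simp
  moreover have "0 < m powr \<theta>"
    using m_ge_3 by simp
  ultimately show ?thesis
    using bound by blast
qed

text \<open>The upper bound holds for every action, by counting group elements; the lower one is
  \<open>growth_X_ge\<close> moved to the base point \<open>t\<close>.\<close>

lemma maximal_growth_X:
  assumes "transitive_right_action G S act'" "s \<in> S" "t \<in> S"
    and "\<And>n. growth G X act' s n = growth G X act (\<one>, False) n"
  shows "maximal_growth (card X) (growth G X act' t)"
proof -
  obtain C where C: "\<And>n. growth G X act' s n \<le> growth G X act' t (n + C)"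
    using growth_shift[OF finite_X assms(1,3,2)] by blast
  have "(2 * card X - 1) ^ n \<le> growth G X act' t (n + (1 + C))" for n
  proof -
    have "real ((2 * card X - 1) ^ n) = m ^ n"
      using card_X by (simp add: m_def of_nat_diff)
    then have "(2 * card X - 1) ^ n \<le> growth G X act (\<one>, False) (n + 1)"
      using growth_X_ge[of n] by (metis of_nat_le_iff)
    then show ?thesis
      using C[of "n + 1"] assms(4) by (simp add: add.assoc)
  qed
  then show ?thesis
    using growth_le_ball[OF finite_X card_X, of act' t]
    unfolding maximal_growth_def growth_equivalent_def by (intro exI[of _ 2] exI[of _ "1 + C"]) simp
qed

lemma exponentially_small_growth_Y:
  obtains \<gamma> :: real where "\<gamma> > 0" "m - \<gamma> > 0"
    "\<And>S act' s t. transitive_right_action G S act' \<Longrightarrow> s \<in> S \<Longrightarrow> t \<in> S \<Longrightarrow>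
      (\<And>n. growth G Y act' s n = growth G Y act (\<one>, False) n) \<Longrightarrow>
      \<forall>\<^sub>F n in sequentially. real (growth G Y act' t n) \<le> (m - \<gamma>) ^ n"
proof -
  obtain B x :: real where x: "0 < x" "x < m" and B: "\<And>n. real (growth G Y act (\<one>, False) n) \<le> B * x ^ n"
    using growth_Y_le by blast
  \<comment> \<open>Half the gap keeps \<open>x\<close> strictly below \<open>m - \<gamma>\<close>,
    so the constant \<open>B * x ^ C\<close>, which includes the change of base point, is eventually
    absorbed. Only \<open>C\<close> depends on \<open>t\<close>, so one \<gamma> serves all base
    points.\<close>
  define \<gamma> where "\<gamma> = (m - x) / 2"
  have \<gamma>: "\<gamma> > 0" "x < m - \<gamma>"
    using x by (auto simp: \<gamma>_def field_simps)
  show ?thesis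
  proof (rule that[of \<gamma>])
    show "\<gamma> > 0" "m - \<gamma> > 0"
      using \<gamma> x by auto
    fix S act' s t
    assume S: "transitive_right_action G S act'" "s \<in> S" "t \<in> S"
      and eq: "\<And>n. growth G Y act' s n = growth G Y act (\<one>, False) n"
    obtain C where C: "\<And>n. growth G Y act' t n \<le> growth G Y act' s (n + C)"
      using Y.growth_shift[OF finite_Y S] by blast
    have "real (growth G Y act' t n) \<le> B * x ^ C * x ^ n" for n
    proof -
      have "real (growth G Y act' t n) \<le> growth G Y act (\<one>, False) (n + C)"
        using C[of n] eq by simp
      also have "\<dots> \<le> B * x ^ (n + C)"
        by (rule B)
      finally show ?thesis
        by (simp add: power_add mult_ac)
    qed
    moreover have "\<forall>\<^sub>F n in sequentially. B * x ^ C * x ^ n \<le> (m - \<gamma>) ^ n"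
      using x(1) \<gamma>(2) by (rule eventually_power_le)
    ultimately show "\<forall>\<^sub>F n in sequentially. real (growth G Y act' t n) \<le> (m - \<gamma>) ^ n"
      by (auto elim!: eventually_mono intro: order_trans)
  qed
qed

end

lemma not_maximal_growth:
  fixes y :: real
  assumes "0 < y" "y < 2 * real r - 1" "\<forall>\<^sub>F n in sequentially. real (f n) \<le> y ^ n"
  shows "\<not> maximal_growth r f"
proof
  assume "maximal_growth r f"
  then obtain C where C: "\<And>n. (2 * r - 1) ^ n \<le> f (n + C)"
    by (auto simp: maximal_growth_def growth_equivalent_def)
  define M where "M = real (2 * r - 1)"
  have M: "M = 2 * real r - 1"
    using assms(1,2) by (simp add: M_def of_nat_diff)
  have "\<forall>\<^sub>F n in sequentially. real (f (n + C)) \<le> y ^ (n + C)"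
    using assms(3) by (rule eventually_all_ge_at_top[THEN eventually_mono]) (auto)
  \<comment> \<open>The factor 2 makes the final comparison contradictory: twice a positive number
    would be at most that number.\<close>
  moreover have "\<forall>\<^sub>F n in sequentially. 2 * y ^ C * y ^ n \<le> M ^ n"
    using assms(1,2) M by (intro eventually_power_le) auto
  ultimately have "\<forall>\<^sub>F n in sequentially. False"
  proof eventually_elim
    case (elim n)
    have "M ^ n \<le> real (f (n + C))"
      using of_nat_mono[OF C[of n], where 'a = real] by (simp add: M_def)
    also have "\<dots> \<le> y ^ C * y ^ n"
      using elim(1) by (simp add: power_add mult_ac)
    finally have "2 * (y ^ C * y ^ n) \<le> y ^ C * y ^ n"
      using elim(2) by (simp add: mult_ac)
    moreover have "y ^ C * y ^ n > 0"
      using assms(1) by simp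
    ultimately show False by linarith
  qed
  then show False by simp
qed

theorem theorem8:
  fixes F :: "('a, 'm) monoid_scheme" and r :: nat
  assumes "r > 1" and "free_group_of_rank F r"
  shows "\<exists>(S :: nat set) (act :: nat \<Rightarrow> 'a \<Rightarrow> nat) X Y.
    transitive_right_action F S act \<and> free_basis F X \<and> free_basis F Y \<and>
    (\<forall>s\<in>S. maximal_growth r (growth F X act s)) \<and>
    (\<forall>s\<in>S. \<not> maximal_growth r (growth F Y act s)) \<and>
    (\<exists>\<gamma>::real. \<gamma> > 0 \<and>
      (\<forall>s\<in>S. \<forall>\<^sub>F n in sequentially.
         real (growth F Y act s n) \<le> (2 * real r - 1 - \<gamma>) ^ n))"
proof -
  obtain X where X: "group F" "free_basis F X" "finite X" "card X = r"
    using assms(2) by (auto simp: free_group_of_rank_def)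
  obtain a where a: "a \<in> X"
    using X(4) assms(1) by fastforce
  have "card (X - {a}) > 0"
    using X a assms(1) by simp
  then obtain b where b: "b \<in> X" "a \<noteq> b"
    by (metis Diff_iff card_gt_0_iff ex_in_conv insertI1)
  interpret group F
    by (rule X(1))
  interpret nielsen_pair F X a b
    by unfold_locales (use X a b in auto)
  let ?P = "core \<times> (UNIV :: bool set)"
  define A where "A = free_group_basis.run F Y move"
  have "right_action F ?P A"
    unfolding A_def by (rule act_right_action)
  moreover have "countable ?P"
    using countable_subset[OF core_closed countable_carrier[OF finite_X]] by simp
  moreover have "(\<one>\<^bsub>F\<^esub>, False) \<in> ?P"
    using wt_good(3)[of "[]" 0] by simp
  \<comment> \<open>The orbit of the identity in the first copy, renumbered by naturals.\<close>
  ultimately obtain S :: "nat set" and act' s where S: "transitive_right_action F S act'" "s \<in> S"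
    and eq: "\<And>Z n. growth F Z act' s n = growth F Z A (\<one>\<^bsub>F\<^esub>, False) n"
    using ex_transitive_action_on_nat by metis
  have m: "m = 2 * real r - 1"
    by (simp add: m_def X(4))
  obtain \<gamma> where \<gamma>: "\<gamma> > 0" "m - \<gamma> > 0"
    and small: "\<And>t. t \<in> S \<Longrightarrow> \<forall>\<^sub>F n in sequentially. real (growth F Y act' t n) \<le> (m - \<gamma>) ^ n"
    using exponentially_small_growth_Y S eq unfolding A_def by metis
  have "\<forall>t\<in>S. maximal_growth r (growth F X act' t)"
    using maximal_growth_X[OF S _ eq[unfolded A_def]] X(4) by simp
  moreover have "\<forall>t\<in>S. \<not> maximal_growth r (growth F Y act' t)"
    using not_maximal_growth[OF \<gamma>(2)] \<gamma>(1) small m by simp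
  moreover have "\<forall>t\<in>S. \<forall>\<^sub>F n in sequentially. real (growth F Y act' t n) \<le> (2 * real r - 1 - \<gamma>) ^ n"
    using small m by simp
  ultimately show ?thesis
    using S(1) X(2) free_basis_Y \<gamma>(1) by blast
qed

end
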